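(* If $D$ is a strong digraph, then at least one of the following holds: (a) $D$ has a $2$-partition $(V_1,V_2)$ such that every vertex of $V_1$ has an out-neighbour in $V_2$ and every vertex of $V_2$ has an in-neighbour in $V_1$; (b) $D$ consists of a single vertex; (c) $D$ has an arc $xy$ with $d^+_D(x)=d^-_D(y)=1$.
   Context: A digraph is strong if for every ordered pair $u,v$ of distinct vertices there is a directed $(u,v)$-path. Digraphs have no loops or parallel arcs. *)

theory Defs
  imports "Graph_Theory.Digraph_Component"
begin

definition two_partition :: "('a, 'b) pre_digraph \<Rightarrow> 'a set \<Rightarrow> 'a set \<Rightarrow> bool" where
  "two_partition D V1 V2 \<longleftrightarrow>
     V1 \<union> V2 = verts D \<and> V1 \<inter> V2 = {} \<and> V1 \<noteq> {} \<and> V2 \<noteq> {}"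

end

theory Submission
  imports Defs
begin

text \<open>Let \<open>H\<close> be a maximal proper vertex subset inducing a strong subdigraph. By maximality a shortest
  ear \<open>a 1, \<dots>, a k\<close> leaving and re-entering \<open>H\<close> covers all vertices outside \<open>H\<close>, and minimality of
  the ear allows only backward arcs besides the path itself. If \<open>c \<rightarrow> a 1\<close> with \<open>c \<in> H\<close>, then \<open>H\<close> can be
  partitioned so that \<open>c\<close> lies in the first part and only \<open>c\<close> may lack an out-neighbour; putting
  \<open>a 1\<close> in the second part repairs \<open>c\<close>. It remains to label \<open>a 2, \<dots>, a k\<close>. For odd \<open>k\<close> the labels
  alternate. For even \<open>k\<close>, either some backward arc closes an even cycle, or two backward arcs
  cross with opposite parity, and each allows the alternation to be shifted by one;
  otherwise, for some \<open>p\<close>, no backward arc leaves \<open>a p\<close> or enters \<open>a (p + 1)\<close>, and the arc between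
  these two vertices is as in (c).\<close>

section \<open>Strong vertex sets and partitions from out-trees\<close>

text \<open>Connecting paths must stay inside \<open>S\<close>. The empty set passes as well, so
  non-emptiness is demanded separately where a maximal strong subset is chosen.\<close>

definition strong_on :: "('a \<times> 'a) set \<Rightarrow> 'a set \<Rightarrow> bool" where
  "strong_on E S \<longleftrightarrow> (\<forall>u\<in>S. \<forall>v\<in>S. (u, v) \<in> (Restr E S)\<^sup>*)"

text \<open>Well-founded recursion computes the winning positions of the game in which a move leads
  from \<open>v\<close> to an \<open>R\<close>-predecessor and a player who cannot move
  loses.\<close>

lemma wf_kernel_exists:
  assumes "wf R"
  shows "\<exists>T. \<forall>v. T v \<longleftrightarrow> (\<exists>u. (u, v) \<in> R \<and> \<not> T u)"
proof -
  let ?F = "\<lambda>T v. \<exists>u. (u, v) \<in> R \<and> \<not> T u"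
  have "wfrec R ?F v \<longleftrightarrow> (\<exists>u. (u, v) \<in> R \<and> \<not> wfrec R ?F u)" for v
    by (subst wfrec[OF assms]) (auto simp: cut_apply)
  then show ?thesis by blast
qed

text \<open>Along a spanning out-tree rooted at \<open>c\<close>, call a vertex winning if it has a losing child;
  \<open>A\<close> consists of the winning vertices and the root.\<close>

lemma rooted_partition_exists:
  assumes fin: "finite H" and c: "c \<in> H" and reach: "\<And>v. v \<in> H \<Longrightarrow> (c, v) \<in> (Restr E H)\<^sup>*"
  obtains A B where "A \<union> B = H" "A \<inter> B = {}" "c \<in> A"
    "\<And>v. v \<in> A \<Longrightarrow> v \<noteq> c \<Longrightarrow> \<exists>u\<in>B. (v, u) \<in> E"
    "\<And>v. v \<in> B \<Longrightarrow> \<exists>u\<in>A. (u, v) \<in> E"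
proof -
  let ?r = "Restr E H"
  \<comment> \<open>\<open>d v\<close> is the distance from \<open>c\<close> inside
    \<open>H\<close>, so the last arc of a shortest path gives \<open>v\<close> a parent one level
    higher.\<close>
  define d where "d v = (LEAST n. (c, v) \<in> ?r ^^ n)" for v
  have d: "(c, v) \<in> ?r ^^ d v" if "v \<in> H" for v
    using rtrancl_imp_relpow[OF reach[OF that]] unfolding d_def by (metis LeastI)
  have "\<exists>u. (u, v) \<in> ?r \<and> d u < d v" if v: "v \<in> H" "v \<noteq> c" for v
  proof -
    obtain n where n: "d v = Suc n"
      using d[OF v(1)] v(2) by (cases "d v") auto
    then obtain u where u: "(c, u) \<in> ?r ^^ n" "(u, v) \<in> ?r"
      using d[OF v(1)] by auto
    have "d u \<le> n" unfolding d_def using u(1) by (rule Least_le)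
    then show ?thesis using u n by auto
  qed
  then obtain p where p: "\<And>v. v \<in> H \<Longrightarrow> v \<noteq> c \<Longrightarrow> (p v, v) \<in> ?r \<and> d (p v) < d v"
    by metis
  \<comment> \<open>Children are the \<open>R\<close>-predecessors of their parent. The root is
    excluded because \<open>p c\<close> is arbitrary. Depth grows towards the children and is
    bounded on the finite \<open>H\<close>, hence the reversed measure below.\<close>
  define R where "R = {(u, v). u \<in> H - {c} \<and> p u = v}"
  have "wf R"
  proof (rule wf_subset[OF wf_measure[of "\<lambda>v. Max (d ` H) - d v"]])
    have "d u \<le> Max (d ` H)" if "u \<in> H" for u
      using fin that by simp
    then show "R \<subseteq> measure (\<lambda>v. Max (d ` H) - d v)"
      using p by (fastforce simp: R_def intro: diff_less_mono2 order.strict_trans2)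
  qed
  then obtain T where T: "\<And>v. T v \<longleftrightarrow> (\<exists>u. (u, v) \<in> R \<and> \<not> T u)"
    using wf_kernel_exists by metis
  let ?A = "{v \<in> H. T v \<or> v = c}" and ?B = "{v \<in> H. \<not> T v \<and> v \<noteq> c}"
  show thesis
  proof (rule that[of ?A ?B])
    show "\<exists>u\<in>?B. (v, u) \<in> E" if "v \<in> ?A" "v \<noteq> c" for v
      using that T[of v] p unfolding R_def by blast
    show "\<exists>u\<in>?A. (u, v) \<in> E" if "v \<in> ?B" for v
    proof (rule bexI[of _ "p v"])
      \<comment> \<open>A losing child makes its parent winning.\<close>
      have "T (p v)" using that T[of "p v"] unfolding R_def by blast
      then show "p v \<in> ?A" "(p v, v) \<in> E" using that p by auto
    qed
  qed (use c in auto)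
qed

section \<open>Ears and shortest ears\<close>

text \<open>Only the vertices outside \<open>H\<close> are listed, counted from 1. Repetitions are
  allowed, since minimality of \<open>k\<close> excludes them later, and the two attaching vertices
  in \<open>H\<close> may coincide.\<close>

definition ear :: "('a \<times> 'a) set \<Rightarrow> 'a set \<Rightarrow> nat \<Rightarrow> (nat \<Rightarrow> 'a) \<Rightarrow> bool" where
  "ear E H k a \<longleftrightarrow> 1 \<le> k \<and> (\<exists>h\<in>H. (h, a 1) \<in> E) \<and> (\<exists>h\<in>H. (a k, h) \<in> E)
     \<and> (\<forall>m\<in>{1..k}. a m \<notin> H) \<and> (\<forall>m\<in>{1..<k}. (a m, a (Suc m)) \<in> E)"

text \<open>A path from \<open>H\<close> to \<open>v\<close> leaves \<open>H\<close> by some arc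
  \<open>(x, y)\<close>. From \<open>y\<close> there is a path back to \<open>H\<close>, and it is
  followed up to its first return.\<close>

lemma ear_exists:
  assumes H: "H \<noteq> {}" and v: "v \<in> V" "v \<notin> H" "H \<subseteq> V" and strong: "strong_on E V"
  shows "\<exists>k a. ear E H k a"
proof -
  obtain h where h: "h \<in> H" using H by auto
  have hv: "(h, v) \<in> E\<^sup>*" "(v, h) \<in> E\<^sup>*"
    using strong h v unfolding strong_on_def
    by (meson Int_lower1 rtrancl_mono subsetD)+
  from hv(1) h v(2) have "\<exists>x y. x \<in> H \<and> y \<notin> H \<and> (x, y) \<in> E \<and> (y, v) \<in> E\<^sup>*"
    by (induction rule: converse_rtrancl_induct) blast+
  then obtain x y where xy: "x \<in> H" "y \<notin> H" "(x, y) \<in> E" "(y, v) \<in> E\<^sup>*" by blast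
  have "(y, h) \<in> E\<^sup>*" using xy(4) hv(2) by simp
  then have "\<exists>k a. 1 \<le> k \<and> a 1 = y \<and> (\<exists>h\<in>H. (a k, h) \<in> E)
     \<and> (\<forall>m\<in>{1..k}. a m \<notin> H) \<and> (\<forall>m\<in>{1..<k}. (a m, a (Suc m)) \<in> E)"
    using xy(2)
  proof (induction rule: converse_rtrancl_induct)
    case base
    then show ?case using h by simp
  next
    case (step y z)
    show ?case
    proof (cases "z \<in> H")
      case True
      then show ?thesis using step by (intro exI[of _ 1] exI[of _ "\<lambda>_. y"]) auto
    next
      case False
      then obtain k a where a: "1 \<le> k" "a 1 = z" "\<exists>h\<in>H. (a k, h) \<in> E"
        "\<forall>m\<in>{1..k}. a m \<notin> H" "\<forall>m\<in>{1..<k}. (a m, a (Suc m)) \<in> E"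
        using step by blast
      \<comment> \<open>Prepending \<open>y\<close> shifts the ear found from \<open>z\<close> by
        one index.\<close>
      let ?b = "\<lambda>m. if m \<le> 1 then y else a (m - 1)"
      have "(?b m, ?b (Suc m)) \<in> E" if "m \<in> {1..<Suc k}" for m
      proof (cases "m = 1")
        case True
        then show ?thesis using a(2) step(1) by simp
      next
        case False
        then have "m - 1 \<in> {1..<k}" "Suc (m - 1) = m" using that by auto
        then show ?thesis using False bspec[OF a(5), of "m - 1"] that by auto
      qed
      moreover have "?b m \<notin> H" if "m \<in> {1..Suc k}" for m
      proof (cases "m = 1")
        case False
        then have "m - 1 \<in> {1..k}" using that by auto
        then show ?thesis using a(4) False that by auto
      qed (use step(4) in simp)
      moreover have "?b (Suc k) = a k" using a(1) by simp
      ultimately show ?thesis using a(3)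
        by (intro exI[of _ "Suc k"] exI[of _ ?b]) simp
    qed
  qed
  then show ?thesis using xy unfolding ear_def by metis
qed

text \<open>A forward chord from \<open>a m\<close> to \<open>a l\<close> bypasses the
  \<open>l - Suc m\<close> vertices strictly between them.\<close>

lemma ear_shortcut:
  assumes ear: "ear E H k a" and ml: "1 \<le> m" "Suc m < l" "l \<le> k" and e: "(a m, a l) \<in> E"
  shows "\<exists>b. ear E H (k - (l - Suc m)) b"
proof -
  let ?s = "l - Suc m"
  let ?b = "\<lambda>n. if n \<le> m then a n else a (n + ?s)"
  have "(?b n, ?b (Suc n)) \<in> E" if "n \<in> {1..<k - ?s}" for n
  proof -
    consider "n < m" | "n = m" | "m < n" by linarith
    then show ?thesis
    proof cases
      case 1
      then show ?thesis using that ear ml unfolding ear_def by auto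
    next
      case 2
      then show ?thesis using e ml by simp
    next
      case 3
      then have "n + ?s \<in> {1..<k}" using that by auto
      then show ?thesis using 3 ear unfolding ear_def by fastforce
    qed
  qed
  moreover have "?b n \<notin> H" if "n \<in> {1..k - ?s}" for n
  proof -
    have "n \<in> {1..k}" "n + ?s \<in> {1..k}" using that ml by auto
    then show ?thesis using ear unfolding ear_def by auto
  qed
  moreover have "?b (k - ?s) = a k" using ml by auto
  moreover have "?b 1 = a 1" using ml by simp
  ultimately have "ear E H (k - ?s) ?b"
    using ear ml unfolding ear_def by auto
  then show ?thesis by blast
qed

text \<open>In an ear of least length, an early return to \<open>H\<close> would allow truncation, a
  late entry from \<open>H\<close> would allow dropping an initial segment, and a forward chord
  would be a shortcut. A repetition \<open>a m = a l\<close> with \<open>m < l\<close> yields an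
  early return if \<open>l = k\<close>, and otherwise a chord from \<open>a m\<close> to
  \<open>a (Suc l)\<close>.\<close>

lemma minimal_ear_exists:
  assumes "H \<noteq> {}" "H \<subset> V" "strong_on E V"
  obtains k a where "ear E H k a" "inj_on a {1..k}"
    "\<And>h m. h \<in> H \<Longrightarrow> m \<in> {1..k} \<Longrightarrow> (h, a m) \<in> E \<Longrightarrow> m = 1"
    "\<And>h m. h \<in> H \<Longrightarrow> m \<in> {1..k} \<Longrightarrow> (a m, h) \<in> E \<Longrightarrow> m = k"
    "\<And>m l. m \<in> {1..k} \<Longrightarrow> l \<in> {1..k} \<Longrightarrow> (a m, a l) \<in> E \<Longrightarrow> l \<le> Suc m"
proof -
  define k where "k = (LEAST k. \<exists>a. ear E H k a)"
  obtain v where "v \<in> V" "v \<notin> H" using assms by auto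
  then have ex: "\<exists>k a. ear E H k a"
    using assms ear_exists[of H v V E] by auto
  then obtain a where a: "ear E H k a"
    unfolding k_def using LeastI_ex[of "\<lambda>k. \<exists>a. ear E H k a"] by blast
  have least: "k \<le> k'" if "ear E H k' b" for k' b
    unfolding k_def using that by (metis (mono_tags, lifting) Least_le)
  have fwd: "l \<le> Suc m" if "m \<in> {1..k}" "l \<in> {1..k}" "(a m, a l) \<in> E" for m l
  proof (rule ccontr)
    assume "\<not> l \<le> Suc m"
    then have "\<exists>b. ear E H (k - (l - Suc m)) b"
      using ear_shortcut[OF a _ _ _ that(3)] that(1,2) by simp
    then have "k \<le> k - (l - Suc m)" using least by blast
    then show False using \<open>\<not> l \<le> Suc m\<close> that by auto
  qed
  have ret: "m = k" if "h \<in> H" "m \<in> {1..k}" "(a m, h) \<in> E" for h m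
  proof -
    have "ear E H m a" using a that unfolding ear_def by auto
    then show ?thesis using least[of m a] that by auto
  qed
  have dep: "m = 1" if "h \<in> H" "m \<in> {1..k}" "(h, a m) \<in> E" for h m
  proof -
    have "ear E H (k - (m - 1)) (\<lambda>n. a (n + (m - 1)))"
      unfolding ear_def
    proof (intro conjI ballI)
      show "a (n + (m - 1)) \<notin> H" if "n \<in> {1..k - (m - 1)}" for n
      proof -
        have "n + (m - 1) \<in> {1..k}" using that by auto
        then show ?thesis using a unfolding ear_def by blast
      qed
      show "(a (n + (m - 1)), a (Suc n + (m - 1))) \<in> E" if "n \<in> {1..<k - (m - 1)}" for n
      proof -
        have "n + (m - 1) \<in> {1..<k}" using that by auto
        then show ?thesis using a unfolding ear_def by fastforce
      qed
    qed (use a that in \<open>auto simp: ear_def\<close>)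
    then have "k \<le> k - (m - 1)" by (rule least)
    then show ?thesis using that by auto
  qed
  have neq: "a m \<noteq> a l" if "m \<in> {1..k}" "l \<in> {1..k}" "m < l" for m l
  proof
    assume eq: "a m = a l"
    show False
    proof (cases "l = k")
      case True
      then show ?thesis using a ret[of _ m] eq that unfolding ear_def by auto
    next
      case False
      then have "(a m, a (Suc l)) \<in> E" using a eq that unfolding ear_def by auto
      then show False using fwd[of m "Suc l"] False that by auto
    qed
  qed
  then have "inj_on a {1..k}" unfolding inj_on_def by (metis linorder_neqE_nat)
  then show thesis using that a dep ret fwd by blast
qed

text \<open>Every vertex is reached from \<open>h0\<close> and reaches \<open>h1\<close>, and
  \<open>h1\<close> reaches \<open>h0\<close> inside \<open>H\<close>.\<close>

lemma strong_on_ear: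
  assumes ear: "ear E H k a" and H: "strong_on E H"
  shows "strong_on E (H \<union> a ` {1..k})"
proof -
  let ?S = "H \<union> a ` {1..k}"
  let ?r = "(Restr E ?S)\<^sup>*"
  obtain h0 h1 where h: "h0 \<in> H" "(h0, a 1) \<in> E" "h1 \<in> H" "(a k, h1) \<in> E"
    and k: "1 \<le> k"
    and st: "\<And>m. m \<in> {1..<k} \<Longrightarrow> (a m, a (Suc m)) \<in> E"
    using ear unfolding ear_def by auto
  have "(Restr E H)\<^sup>* \<subseteq> ?r" by (rule rtrancl_mono) auto
  then have HH: "(u, v) \<in> ?r" if "u \<in> H" "v \<in> H" for u v
    using H that unfolding strong_on_def by blast
  have from_h: "(h0, a m) \<in> ?r" if "1 \<le> m" "m \<le> k" for m
    using that
  proof (induction m rule: dec_induct)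
    case base
    then show ?case using h k by auto
  next
    case (step m)
    then have "(a m, a (Suc m)) \<in> Restr E ?S" using st by auto
    with step show ?case by (meson Suc_leD rtrancl.rtrancl_into_rtrancl)
  qed
  have to_h: "(a m, h1) \<in> ?r" if "m \<le> k" "1 \<le> m" for m
    using that
  proof (induction m rule: inc_induct)
    case base
    then show ?case using h k by auto
  next
    case (step m)
    then have "(a m, a (Suc m)) \<in> Restr E ?S" using st by auto
    with step show ?case by (meson converse_rtrancl_into_rtrancl le_SucI)
  qed
  have "(u, h1) \<in> ?r" "(h0, u) \<in> ?r" if "u \<in> ?S" for u
    using that HH h from_h to_h by auto
  then show ?thesis
    unfolding strong_on_def using HH[OF h(3) h(1)] by (meson rtrancl_trans)
qed

section \<open>From labellings of the ear to partitions\<close>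

text \<open>Here \<open>P m\<close> means that \<open>a m\<close> belongs to the second part; \<open>a 1\<close> is served by \<open>H\<close>,
  and at the same time serves as out-neighbour of the root chosen in \<open>H\<close>.\<close>

lemma partition_from_labelling:
  assumes fin: "finite V" and H: "H \<subset> V" "strong_on E H"
    and ear: "ear E H k a" "inj_on a {1..k}" "V = H \<union> a ` {1..k}"
    and P1: "P 1"
    and heads: "\<And>m. m \<in> {2..k} \<Longrightarrow> P m \<Longrightarrow> \<exists>l\<in>{1..k}. \<not> P l \<and> (a l, a m) \<in> E"
    and tails: "\<And>m. m \<in> {2..k} \<Longrightarrow> \<not> P m \<Longrightarrow> \<exists>l\<in>{1..k}. P l \<and> (a m, a l) \<in> E"
  shows "\<exists>V1 V2. V1 \<union> V2 = V \<and> V1 \<inter> V2 = {} \<and> V1 \<noteq> {} \<and> V2 \<noteq> {}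
    \<and> (\<forall>u\<in>V1. \<exists>v\<in>V2. (u, v) \<in> E) \<and> (\<forall>v\<in>V2. \<exists>u\<in>V1. (u, v) \<in> E)"
proof -
  obtain c where c: "c \<in> H" "(c, a 1) \<in> E" and k: "1 \<le> k"
    and out: "\<And>m. m \<in> {1..k} \<Longrightarrow> a m \<notin> H"
    using ear(1) unfolding ear_def by auto
  have "finite H" using fin H by (meson finite_subset psubset_imp_subset)
  moreover have "(c, v) \<in> (Restr E H)\<^sup>*" if "v \<in> H" for v
    using H c that unfolding strong_on_def by blast
  ultimately obtain A B where AB: "A \<union> B = H" "A \<inter> B = {}" "c \<in> A"
    "\<And>v. v \<in> A \<Longrightarrow> v \<noteq> c \<Longrightarrow> \<exists>u\<in>B. (v, u) \<in> E"
    "\<And>v. v \<in> B \<Longrightarrow> \<exists>u\<in>A. (u, v) \<in> E"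
    using rooted_partition_exists[of H c E] c(1) by blast
  let ?V1 = "A \<union> a ` {m \<in> {1..k}. \<not> P m}" and ?V2 = "B \<union> a ` {m \<in> {1..k}. P m}"
  have a1: "a 1 \<in> ?V2" using P1 k by auto
  have "?V1 \<union> ?V2 = V" using ear(3) AB(1) by auto
  moreover have "?V1 \<inter> ?V2 = {}"
    using AB(1,2) out inj_onD[OF ear(2)] by auto
  moreover have "\<exists>v\<in>?V2. (u, v) \<in> E" if "u \<in> ?V1" for u
    using that
  proof
    assume "u \<in> A"
    then show ?thesis using AB(4)[of u] c(2) a1 by (cases "u = c") auto
  next
    assume "u \<in> a ` {m \<in> {1..k}. \<not> P m}"
    then obtain m where m: "u = a m" "m \<in> {1..k}" "\<not> P m" by auto
    then have "m \<in> {2..k}" using P1 by (cases "m = 1") auto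
    then show ?thesis using tails[of m] m by auto
  qed
  moreover have "\<exists>u\<in>?V1. (u, v) \<in> E" if "v \<in> ?V2" for v
    using that
  proof
    assume "v \<in> B"
    then show ?thesis using AB(5)[of v] by auto
  next
    assume "v \<in> a ` {m \<in> {1..k}. P m}"
    then obtain m where m: "v = a m" "m \<in> {1..k}" "P m" by auto
    show ?thesis
    proof (cases "m = 1")
      case True
      then show ?thesis using m c AB(3) by auto
    next
      case False
      then have "m \<in> {2..k}" using m by auto
      then show ?thesis using heads[of m] m by auto
    qed
  qed
  moreover have "?V1 \<noteq> {}" "?V2 \<noteq> {}" using a1 AB(3) by blast+
  ultimately show ?thesis
    by (intro exI[of _ ?V1] exI[of _ ?V2] conjI ballI)
qed

section \<open>Admissible labellings of the ear\<close>

text \<open>A pair \<open>(i, j) \<in> K\<close> stands for a backward arc from \<open>a i\<close> to \<open>a j\<close>.\<close>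

definition admissible :: "(nat \<times> nat) set \<Rightarrow> nat \<Rightarrow> (nat \<Rightarrow> bool) \<Rightarrow> bool" where
  "admissible K k P \<longleftrightarrow> P 1
     \<and> (\<forall>m\<in>{2..k}. P m \<longrightarrow> \<not> P (m - 1) \<or> (\<exists>i. (i, m) \<in> K \<and> \<not> P i))
     \<and> (\<forall>m\<in>{2..k}. \<not> P m \<longrightarrow> m < k \<and> P (Suc m) \<or> (\<exists>j. (m, j) \<in> K \<and> P j))"

text \<open>Backward arcs are needed only where the alternation breaks, or at a last vertex with
  label false.\<close>

lemma admissibleI:
  assumes "P 1"
    and "\<And>m. m \<in> {2..k} \<Longrightarrow> P m \<Longrightarrow> P (m - 1) \<Longrightarrow> \<exists>i. (i, m) \<in> K \<and> \<not> P i"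
    and "\<And>m. m \<in> {2..k} \<Longrightarrow> \<not> P m \<Longrightarrow> m = k \<or> \<not> P (Suc m) \<Longrightarrow> \<exists>j. (m, j) \<in> K \<and> P j"
  shows "admissible K k P"
  unfolding admissible_def
proof (intro conjI ballI impI)
  fix m assume m: "m \<in> {2..k}"
  show "\<not> P (m - 1) \<or> (\<exists>i. (i, m) \<in> K \<and> \<not> P i)" if "P m"
    using assms(2)[OF m that] by blast
  show "m < k \<and> P (Suc m) \<or> (\<exists>j. (m, j) \<in> K \<and> P j)" if "\<not> P m"
    using assms(3)[OF m that] m by (cases "m = k") auto
qed (rule assms(1))

text \<open>Strict alternation works because the last vertex gets label true.\<close>

lemma admissible_odd_length: "odd k \<Longrightarrow> admissible K k odd"
  by (rule admissibleI) auto

text \<open>One shift of the alternation makes the label of \<open>k\<close> true. For odd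
  \<open>j\<close> it comes right after \<open>i\<close>, whose missing out-neighbour is
  \<open>j\<close>; if \<open>i = k\<close>, the arc serves the last vertex directly. For even
  \<open>j\<close> it comes right before \<open>j\<close>, whose missing in-neighbour is
  \<open>i\<close>.\<close>

lemma admissible_even_cycle:
  assumes k: "even k" and ij: "(i, j) \<in> K" "1 \<le> j" "j < i" "i \<le> k" "odd (i - j)"
  shows "\<exists>P. admissible K k P"
proof (cases "odd j")
  case True
  then have i: "even i" using ij by auto
  let ?P = "\<lambda>m. if m \<le> i then odd m else even m"
  have h: False if "m \<in> {2..k}" "?P m" "?P (m - 1)" for m
    using that i by (cases "m \<le> i"; cases "m = Suc i") (auto split: if_splits)
  have t: "m = i" if "m \<in> {2..k}" "\<not> ?P m" "m = k \<or> \<not> ?P (Suc m)" for m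
    using that i k ij(4) by (auto split: if_splits)
  have "admissible K k ?P"
  proof (rule admissibleI)
    show "?P 1" using ij by simp
    show "\<exists>l. (l, m) \<in> K \<and> \<not> ?P l" if "m \<in> {2..k}" "?P m" "?P (m - 1)" for m
      using h[OF that] by blast
    show "\<exists>l. (m, l) \<in> K \<and> ?P l" if "m \<in> {2..k}" "\<not> ?P m" "m = k \<or> \<not> ?P (Suc m)" for m
      using t[OF that] ij True by (intro exI[of _ j]) auto
  qed
  then show ?thesis by blast
next
  case False
  then have i: "odd i" using ij by auto
  let ?P = "\<lambda>m. if m < j then odd m else even m"
  have h: "m = j" if "m \<in> {2..k}" "?P m" "?P (m - 1)" for m
    using that False by (auto split: if_splits)
  have t: False if "m \<in> {2..k}" "\<not> ?P m" "m = k \<or> \<not> ?P (Suc m)" for m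
    using that False k ij by (cases "Suc m = j") (auto split: if_splits)
  have "admissible K k ?P"
  proof (rule admissibleI)
    show "?P 1" using ij False by (cases "j = 1") auto
    show "\<exists>l. (l, m) \<in> K \<and> \<not> ?P l" if "m \<in> {2..k}" "?P m" "?P (m - 1)" for m
      using h[OF that] ij i by (intro exI[of _ i]) auto
    show "\<exists>l. (m, l) \<in> K \<and> ?P l" if "m \<in> {2..k}" "\<not> ?P m" "m = k \<or> \<not> ?P (Suc m)" for m
      using t[OF that] by blast
  qed
  then show ?thesis by blast
qed

text \<open>Since both arcs span an even distance, no single shift is repaired by one arc; three
  shifts are made instead. For odd \<open>j\<close> they follow \<open>j\<close>, \<open>i\<close>
  and \<open>l\<close> (the last is vacuous if \<open>l = k\<close>); for even \<open>j\<close> they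
  precede \<open>j\<close>, follow \<open>j\<close> and follow \<open>i\<close>. The arc to
  \<open>j\<close> serves both of its ends if \<open>j\<close> is even and only \<open>i\<close> if
  \<open>j\<close> is odd; for the arc from \<open>l\<close> to \<open>Suc j\<close>, it is both
  ends if \<open>j\<close> is odd and only \<open>Suc j\<close> if \<open>j\<close> is even.\<close>

lemma admissible_crossing:
  assumes k: "even k" and ij: "(i, j) \<in> K" "1 \<le> j" "j < i" "even (i - j)"
    and lj: "(l, Suc j) \<in> K" "i < l" "l \<le> k" "even (l - Suc j)"
  shows "\<exists>P. admissible K k P"
proof (cases "odd j")
  case True
  then have par: "odd i" "even l" using ij lj by auto
  have ord: "Suc j < i" using True par ij by (cases "i = Suc j") auto
  let ?P = "\<lambda>m. if m \<le> j then odd m else if m \<le> i then even m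
    else if m \<le> l then odd m else even m"
  have h: "m = Suc j" if "m \<in> {2..k}" "?P m" "?P (m - 1)" for m
    using that par True ord lj(2)
    by (cases "m = Suc j"; cases "m = Suc i"; cases "m = Suc l") (auto split: if_splits)
  have t: "m = i \<or> m = l" if "m \<in> {2..k}" "\<not> ?P m" "m = k \<or> \<not> ?P (Suc m)" for m
    using that par True ord lj(2,3) k
    by (cases "m = j"; cases "m = i"; cases "m = l"; cases "m = k") (auto split: if_splits)
  have "admissible K k ?P"
  proof (rule admissibleI)
    show "?P 1" using ij by simp
    show "\<exists>n. (n, m) \<in> K \<and> \<not> ?P n" if "m \<in> {2..k}" "?P m" "?P (m - 1)" for m
      using h[OF that] lj ord par by (intro exI[of _ l]) auto
    show "\<exists>n. (m, n) \<in> K \<and> ?P n" if "m \<in> {2..k}" "\<not> ?P m" "m = k \<or> \<not> ?P (Suc m)" for m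
      using t[OF that]
    proof
      assume "m = i"
      then show ?thesis using ij True by (intro exI[of _ j]) auto
    next
      assume "m = l"
      then show ?thesis using lj ord True by (intro exI[of _ "Suc j"]) auto
    qed
  qed
  then show ?thesis by blast
next
  case False
  then have par: "even i" "odd l" using ij lj by auto
  have ord: "Suc j < i" using False par ij by (cases "i = Suc j") auto
  let ?P = "\<lambda>m. if m < j then odd m else if m = j then True else if m \<le> i then odd m
    else even m"
  have h: "m = j \<or> m = Suc j" if "m \<in> {2..k}" "?P m" "?P (m - 1)" for m
    using that par False ord
    by (cases "m = Suc j"; cases "m = Suc i"; cases "m = j") (auto split: if_splits)
  have t: "m = i" if "m \<in> {2..k}" "\<not> ?P m" "m = k \<or> \<not> ?P (Suc m)" for m
    using that par False ord lj(2,3) k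
    by (cases "Suc m = j"; cases "m = i"; cases "m = j"; cases "m = k") (auto split: if_splits)
  have "admissible K k ?P"
  proof (rule admissibleI)
    show "?P 1" using ij by simp
    show "\<exists>n. (n, m) \<in> K \<and> \<not> ?P n" if "m \<in> {2..k}" "?P m" "?P (m - 1)" for m
      using h[OF that]
    proof
      assume "m = j"
      then show ?thesis using ij par by (intro exI[of _ i]) auto
    next
      assume "m = Suc j"
      then show ?thesis using lj ord par by (intro exI[of _ l]) auto
    qed
    show "\<exists>n. (m, n) \<in> K \<and> ?P n" if "m \<in> {2..k}" "\<not> ?P m" "m = k \<or> \<not> ?P (Suc m)" for m
      using t[OF that] ij by (intro exI[of _ j]) auto
  qed
  then show ?thesis by blast
qed

text \<open>Among the backward arcs \<open>(i, j)\<close> take one with \<open>i\<close> least: then none leaves \<open>j\<close>, and one entering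
  \<open>j + 1\<close> either crosses \<open>(i, j)\<close> or also leaves \<open>i\<close>, in which case one of the two closes an
  even cycle.\<close>

lemma admissible_or_free_step:
  assumes K: "\<And>i j. (i, j) \<in> K \<Longrightarrow> 1 \<le> j \<and> j < i \<and> i \<le> k" and k: "1 \<le> k"
  shows "(\<exists>P. admissible K k P)
    \<or> (\<exists>p\<in>{1..<k}. (\<forall>l. (p, l) \<notin> K) \<and> (\<forall>l. (l, Suc p) \<notin> K))"
proof (rule disjCI)
  assume covered: "\<not> (\<exists>p\<in>{1..<k}. (\<forall>l. (p, l) \<notin> K) \<and> (\<forall>l. (l, Suc p) \<notin> K))"
  show "\<exists>P. admissible K k P"
  proof (cases "odd k")
    case True
    then show ?thesis using admissible_odd_length by blast
  next
    case False
    \<comment> \<open>Without any backward arc, \<open>p = 1\<close> would be a free step.\<close>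
    then have "1 \<in> {1..<k}" using k by (cases "k = 1") auto
    then have ex: "\<exists>i j. (i, j) \<in> K" using covered by blast
    define i where "i = (LEAST i. \<exists>j. (i, j) \<in> K)"
    obtain j where ij: "(i, j) \<in> K"
      unfolding i_def using LeastI_ex[OF ex] by blast
    have least: "i \<le> i'" if "(i', j') \<in> K" for i' j'
      unfolding i_def using that by (metis (mono_tags, lifting) Least_le)
    have b: "1 \<le> j" "j < i" "i \<le> k" using K[OF ij] by auto
    \<comment> \<open>\<open>covered\<close> is applied at \<open>p = j\<close>, which is in range
      because \<open>j < i \<le> k\<close>.\<close>
    then obtain l where l: "(l, Suc j) \<in> K"
      using covered least[of j] by fastforce
    have bl: "Suc j < l" "l \<le> k" "i \<le> l" using K[OF l] least[OF l] by auto
    consider "odd (i - j)" | "odd (l - Suc j)" | "even (i - j)" "even (l - Suc j)" by blast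
    then show ?thesis
    proof cases
      case 1
      then show ?thesis using admissible_even_cycle[OF _ ij] b False by blast
    next
      case 2
      then show ?thesis using admissible_even_cycle[OF _ l] bl False by auto
    next
      case 3
      \<comment> \<open>Otherwise the consecutive numbers \<open>i - Suc j\<close> and
        \<open>i - j\<close> would both be even.\<close>
      then have "i \<noteq> l" using b bl by auto
      then show ?thesis using admissible_crossing[OF _ ij _ _ _ l] 3 b bl False by auto
    qed
  qed
qed

section \<open>The trichotomy for finite strong relations\<close>

text \<open>Phrased for a bare arc relation, with unique neighbours in place of degrees, so that
  arcs as objects enter only in the final transfer.\<close>

lemma strong_relation_trichotomy:
  assumes fin: "finite V" and E: "E \<subseteq> V \<times> V" and irr: "\<And>x. (x, x) \<notin> E"
    and strong: "strong_on E V" and ne: "V \<noteq> {}"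
  shows "(\<exists>V1 V2. V1 \<union> V2 = V \<and> V1 \<inter> V2 = {} \<and> V1 \<noteq> {} \<and> V2 \<noteq> {}
      \<and> (\<forall>u\<in>V1. \<exists>v\<in>V2. (u, v) \<in> E) \<and> (\<forall>v\<in>V2. \<exists>u\<in>V1. (u, v) \<in> E))
    \<or> (\<exists>v. V = {v})
    \<or> (\<exists>x y. (x, y) \<in> E \<and> (\<forall>z. (x, z) \<in> E \<longrightarrow> z = y) \<and> (\<forall>z. (z, y) \<in> E \<longrightarrow> z = x))"
    (is "?partition \<or> ?single \<or> ?arc")
proof (cases "?single")
  case False
  obtain v where v: "v \<in> V" using ne by auto
  let ?F = "{S. S \<noteq> {} \<and> S \<subset> V \<and> strong_on E S}"
  have "finite ?F" by (rule finite_subset[of _ "Pow V"]) (use fin in auto)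
  \<comment> \<open>A singleton starts the family; it is a proper subset because case (b) is
    excluded.\<close>
  moreover have "{v} \<in> ?F" using v False by (auto simp: strong_on_def)
  ultimately have "\<exists>H\<in>?F. \<forall>S\<in>?F. H \<subseteq> S \<longrightarrow> H = S"
    by (intro finite_has_maximal) (simp_all only: ex_in_conv[symmetric], rule exI)
  then obtain H where H: "H \<in> ?F" and max: "\<And>S. S \<in> ?F \<Longrightarrow> H \<subseteq> S \<Longrightarrow> H = S"
    by (elim bexE) simp
  have Hs: "H \<noteq> {}" "H \<subset> V" "strong_on E H" using H by simp_all
  obtain k a where ear: "ear E H k a" and inj: "inj_on a {1..k}"
    and dep: "\<And>h m. h \<in> H \<Longrightarrow> m \<in> {1..k} \<Longrightarrow> (h, a m) \<in> E \<Longrightarrow> m = 1"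
    and ret: "\<And>h m. h \<in> H \<Longrightarrow> m \<in> {1..k} \<Longrightarrow> (a m, h) \<in> E \<Longrightarrow> m = k"
    and fwd: "\<And>m l. m \<in> {1..k} \<Longrightarrow> l \<in> {1..k} \<Longrightarrow> (a m, a l) \<in> E \<Longrightarrow> l \<le> Suc m"
    by (rule minimal_ear_exists[OF Hs(1,2) strong]) (rule that)
  have k: "1 \<le> k" and a1: "a 1 \<notin> H"
    and st: "\<And>m. m \<in> {1..<k} \<Longrightarrow> (a m, a (Suc m)) \<in> E"
    using ear unfolding ear_def by auto
  have "a m \<in> V" if "m \<in> {1..k}" for m
  proof (cases "m = k")
    case True
    then show ?thesis using ear E unfolding ear_def by auto
  next
    case False
    then show ?thesis using st[of m] that E by auto
  qed
  then have sub: "H \<union> a ` {1..k} \<subseteq> V" using Hs(2) by auto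
  have V: "V = H \<union> a ` {1..k}"
  proof (rule ccontr)
    assume "V \<noteq> H \<union> a ` {1..k}"
    then have "H \<union> a ` {1..k} \<in> ?F"
      using strong_on_ear[OF ear Hs(3)] Hs(1) sub by (simp add: psubset_eq)
    then have "H = H \<union> a ` {1..k}" by (rule max) simp
    then show False using a1 k by auto
  qed
  define K where "K = {(i, j). (a i, a j) \<in> E \<and> 1 \<le> j \<and> j < i \<and> i \<le> k}"
  have "(\<exists>P. admissible K k P)
    \<or> (\<exists>p\<in>{1..<k}. (\<forall>l. (p, l) \<notin> K) \<and> (\<forall>l. (l, Suc p) \<notin> K))"
    by (rule admissible_or_free_step) (use k in \<open>auto simp: K_def\<close>)
  then show ?thesis
  proof
    assume "\<exists>P. admissible K k P"
    then obtain P where P: "admissible K k P" by blast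
    have "?partition"
    proof (rule partition_from_labelling[OF fin _ _ ear inj V])
      show "H \<subset> V" "strong_on E H" using Hs by simp_all
      show "P 1" using P unfolding admissible_def by blast
      show "\<exists>l\<in>{1..k}. \<not> P l \<and> (a l, a m) \<in> E" if m: "m \<in> {2..k}" "P m" for m
      proof (cases "P (m - 1)")
        case True
        then obtain i where "(i, m) \<in> K" "\<not> P i" using P m unfolding admissible_def by blast
        then show ?thesis by (auto simp: K_def)
      next
        case False
        moreover have "m - 1 \<in> {1..<k}" "Suc (m - 1) = m" using m by auto
        ultimately show ?thesis using st[of "m - 1"] by (intro bexI[of _ "m - 1"]) auto
      qed
      show "\<exists>l\<in>{1..k}. P l \<and> (a m, a l) \<in> E" if m: "m \<in> {2..k}" "\<not> P m" for m
      proof (cases "m < k \<and> P (Suc m)")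
        case True
        then show ?thesis using st[of m] m by (intro bexI[of _ "Suc m"]) auto
      next
        case False
        then obtain j where "(m, j) \<in> K" "P j" using P m unfolding admissible_def by blast
        then show ?thesis by (auto simp: K_def)
      qed
    qed
    then show ?thesis by blast
  next
    assume "\<exists>p\<in>{1..<k}. (\<forall>l. (p, l) \<notin> K) \<and> (\<forall>l. (l, Suc p) \<notin> K)"
    then obtain p where p: "p \<in> {1..<k}" "\<And>l. (p, l) \<notin> K" "\<And>l. (l, Suc p) \<notin> K" by blast
    \<comment> \<open>The target is not in \<open>H\<close> since \<open>p < k\<close>, not beyond
      \<open>Suc p\<close> since there are no forward chords, and not before \<open>p\<close> by the
      choice of \<open>p\<close>. The sources of arcs into \<open>a (Suc p)\<close> are treated
      symmetrically.\<close>
    have "z = a (Suc p)" if z: "(a p, z) \<in> E" for z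
    proof -
      have "z \<in> V" using z E by auto
      moreover have "z \<notin> H" using ret[of z p] z p(1) by auto
      ultimately obtain l where l: "z = a l" "l \<in> {1..k}" using V by auto
      then have "l \<le> Suc p" using fwd[of p l] z p(1) by auto
      moreover have "l \<noteq> p" using z l irr by auto
      moreover have "\<not> l < p" using p(1) p(2)[of l] z l by (auto simp: K_def)
      ultimately show ?thesis using l by (metis le_SucE linorder_neqE_nat not_less)
    qed
    moreover have "z = a p" if z: "(z, a (Suc p)) \<in> E" for z
    proof -
      have "z \<in> V" using z E by auto
      moreover have "z \<notin> H" using dep[of z "Suc p"] z p(1) by auto
      ultimately obtain l where l: "z = a l" "l \<in> {1..k}" using V by auto
      then have "p \<le> l" using fwd[of l "Suc p"] z p(1) by auto
      moreover have "l \<noteq> Suc p" using z l irr by auto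
      moreover have "\<not> Suc p < l" using p(1) p(3)[of l] z l by (auto simp: K_def)
      ultimately have "l = p" by linarith
      then show ?thesis using l by simp
    qed
    ultimately have "?arc" using st[OF p(1)] by blast
    then show ?thesis by blast
  qed
qed blast

section \<open>Degrees and transfer to digraphs\<close>

text \<open>Degrees count arcs, so uniqueness of the neighbour is combined with the absence of
  parallel arcs.\<close>

lemma (in digraph) out_degree_eq_1:
  assumes "x \<rightarrow>\<^bsub>G\<^esub> y" "\<And>z. x \<rightarrow>\<^bsub>G\<^esub> z \<Longrightarrow> z = y"
  shows "out_degree G x = 1"
proof -
  obtain e where e: "e \<in> arcs G" "tail G e = x" "head G e = y"
    using assms(1) by (auto simp: arcs_ends_def arc_to_ends_def)
  have "e' = e" if "e' \<in> out_arcs G x" for e'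
  proof -
    have "head G e' = y" using that assms(2)[of "head G e'"] by (auto intro: in_arcs_imp_in_arcs_ends)
    then show ?thesis using that e no_multi_arcs[of e' e] by (auto simp: arc_to_ends_def)
  qed
  moreover have "e \<in> out_arcs G x" using e by simp
  ultimately have "out_arcs G x = {e}" by blast
  then show ?thesis by (simp add: out_degree_def)
qed

lemma (in digraph) in_degree_eq_1:
  assumes "x \<rightarrow>\<^bsub>G\<^esub> y" "\<And>z. z \<rightarrow>\<^bsub>G\<^esub> y \<Longrightarrow> z = x"
  shows "in_degree G y = 1"
proof -
  obtain e where e: "e \<in> arcs G" "tail G e = x" "head G e = y"
    using assms(1) by (auto simp: arcs_ends_def arc_to_ends_def)
  have "e' = e" if "e' \<in> in_arcs G y" for e'
  proof -
    have "tail G e' = x" using that assms(2)[of "tail G e'"] by (auto intro: in_arcs_imp_in_arcs_ends)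
    then show ?thesis using that e no_multi_arcs[of e' e] by (auto simp: arc_to_ends_def)
  qed
  moreover have "e \<in> in_arcs G y" using e by simp
  ultimately have "in_arcs G y = {e}" by blast
  then show ?thesis by (simp add: in_degree_def)
qed

theorem theorem5p5:
  fixes D :: "('a, 'b) pre_digraph"
  assumes "digraph D"
    and "strongly_connected D"
  shows "(\<exists>V1 V2. two_partition D V1 V2
            \<and> (\<forall>u\<in>V1. \<exists>v\<in>V2. u \<rightarrow>\<^bsub>D\<^esub> v)
            \<and> (\<forall>v\<in>V2. \<exists>u\<in>V1. u \<rightarrow>\<^bsub>D\<^esub> v))
       \<or> (\<exists>v. verts D = {v})
       \<or> (\<exists>x y. x \<rightarrow>\<^bsub>D\<^esub> y \<and> out_degree D x = 1 \<and> in_degree D y = 1)"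
proof -
  interpret digraph D by (rule assms(1))
  have E: "arcs_ends D \<subseteq> verts D \<times> verts D"
    by (auto simp: arcs_ends_def arc_to_ends_def)
  then have "Restr (arcs_ends D) (verts D) = arcs_ends D" by auto
  moreover have "(u, v) \<in> (arcs_ends D)\<^sup>*" if "u \<in> verts D" "v \<in> verts D" for u v
    using assms(2) that unfolding strongly_connected_def reachable_def
    by (meson rtrancl_on_rtranclI)
  ultimately have strong: "strong_on (arcs_ends D) (verts D)"
    by (simp add: strong_on_def)
  have irr: "(x, x) \<notin> arcs_ends D" for x
    using adj_not_same by blast
  have ne: "verts D \<noteq> {}" using assms(2) by (simp add: strongly_connected_def)
  show ?thesis
    using strong_relation_trichotomy[OF finite_verts E irr strong ne]
  proof (elim disjE exE conjE, goal_cases)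
    case (1 V1 V2)
    then have "two_partition D V1 V2" by (simp add: two_partition_def)
    with 1 show ?case by blast
  next
    case (2 v)
    then show ?case by blast
  next
    case (3 x y)
    have "out_degree D x = 1" by (rule out_degree_eq_1[OF 3(1)]) (use 3(2) in blast)
    moreover have "in_degree D y = 1" by (rule in_degree_eq_1[OF 3(1)]) (use 3(3) in blast)
    ultimately show ?case using 3(1) by blast
  qed
qed

end
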